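(* Let $G:\mathbb{R}_+\times\mathcal{S}\to\mathbb{R}_+$ satisfy Assumption (A) of the context. Let $P^*\in\Delta^T$ be a solution of the generalized maximum causal entropy problem $$\max_{P\in\Delta^T}\ \mathbb{E}^P_{\mathbf{A},\mathbf{S}}\Big[-\sum_{t=0}^{T-1}\ln G(P(a_t|s_t)|s_t)\Big]\quad\text{subject to}\quad \mathbb{E}^P_{\mathbf{A},\mathbf{S}}[R(\mathbf{S},\mathbf{A})]=\eta .$$ Then $P^*$ minimizes the generalized worst-case prediction log-loss, i.e. $Q=P^*$ attains the infimum in $$\inf_{Q\in\Delta^T}\ \sup_{\substack{P\in\Delta^T\\ \mathbb{E}^P_{\mathbf{A},\mathbf{S}}[R(\mathbf{S},\mathbf{A})]=\eta}}\ \mathbb{E}^P_{\mathbf{A},\mathbf{S}}\Big[-\sum_{t=0}^{T-1}\ln G(Q(a_t|s_t)|s_t)\Big].$$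
   Context: Setting: a finite-horizon undiscounted Markov decision process with finite state set $\mathcal{S}$, finite action set $\mathcal{A}$, transition probabilities $p(s'|a,s)$, real-valued reward $R(s,a)$, horizon $T\ge 1$, a given distribution of the initial state $s_0$, and for each time $t\in\{0,\dots,T-1\}$ a nonempty set $\mathcal{A}^t\subseteq\mathcal{A}$ of available actions. Here $\mathbb{R}_+=(0,\infty)$. $\Delta^T$ is the set of (time-dependent) policies $P=(P(a_t|s_t))$ with $t\in\{0,\dots,T-1\}$, $s_t\in\mathcal{S}$, $a_t\in\mathcal{A}^t$, with values in $\mathbb{R}_+$ and $\sum_{a_t\in\mathcal{A}^t}P(a_t|s_t)=1$ for all $t,s_t$; the value may depend on $t$. Together with the initial distribution and $p$, a policy $P$ determines the law of the random sequences $\mathbf{S}=(s_0,\dots,s_{T-1})$, $\mathbf{A}=(a_0,\dots,a_{T-1})$: $a_t$ is drawn from $P(\cdot|s_t)$ and $s_{t+1}$ from $p(\cdot|a_t,s_t)$; $\mathbb{E}^P_{\mathbf{A},\mathbf{S}}$ denotes expectation under this law. Put $R(\mathbf{S},\mathbf{A})=\sum_{t=0}^{T-1}R(s_t,a_t)$. The real number $\eta$ is given (the empirical expectation of the accumulated reward over demonstrated trajectories). Assumption (A): for every $s\in\mathcal{S}$ and $p\in\mathbb{R}_+$, (i) $G(p|s)$ and $\partial G(p|s)/\partial p$ exist and are positive; (ii) $G(\cdot|s)$ is invertible, i.e. there is a unique function $G^{-1}(\cdot|s):\mathbb{R}_+\to\mathbb{R}_+$ with $G^{-1}(G(p|s)|s)=p$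 for all $p\in\mathbb{R}_+$; (iii) there is a mapping $\mu:\mathcal{S}\to\mathbb{R}_+$ with $\partial \ln G(p|s)/\partial p=\mu(s)/p$. *)

theory Defs
  imports "HOL-Probability.Probability"
begin

text \<open>
  Conventions: \<open>p a s\<close> is the law of the next state when action \<open>a\<close> is taken in state \<open>s\<close>;
  \<open>P t s\<close> is the law of the action at time \<open>t\<close> in state \<open>s\<close>, so that \<open>pmf (P t s) a\<close> is
  \<open>P(a|s)\<close> at time \<open>t\<close>; \<open>Av t\<close> is the set of actions available at time \<open>t\<close>.
\<close>

type_synonym ('s, 'a) policy = "nat \<Rightarrow> 's \<Rightarrow> 'a pmf"
type_synonym ('s, 'a) trajectory = "('s \<times> 'a) list"

text \<open>The values of a policy at times \<open>t \<ge> T\<close> are irrelevant and left unconstrained.\<close>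

definition policies :: "nat \<Rightarrow> (nat \<Rightarrow> 'a set) \<Rightarrow> ('s, 'a) policy set" where
  "policies T Av = {P. \<forall>t<T. \<forall>s.
     (\<forall>a\<in>Av t. 0 < pmf (P t s) a) \<and> (\<Sum>a\<in>Av t. pmf (P t s) a) = 1}"

text \<open>
  \<open>trajectory_from p P n t s\<close> is the law of the \<open>n\<close> state-action pairs visited from time \<open>t\<close> on,
  given that the state at time \<open>t\<close> is \<open>s\<close>. The successor of the last state is drawn but not
  recorded.
\<close>

primrec trajectory_from ::
  "('a \<Rightarrow> 's \<Rightarrow> 's pmf) \<Rightarrow> ('s, 'a) policy \<Rightarrow> nat \<Rightarrow> nat \<Rightarrow> 's \<Rightarrow> ('s, 'a) trajectory pmf" where
  "trajectory_from p P 0 t s = return_pmf []"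
| "trajectory_from p P (Suc n) t s =
     bind_pmf (P t s) (\<lambda>a. bind_pmf (p a s) (\<lambda>s'.
       map_pmf (\<lambda>w. (s, a) # w) (trajectory_from p P n (Suc t) s')))"

definition trajectory_law ::
  "nat \<Rightarrow> 's pmf \<Rightarrow> ('a \<Rightarrow> 's \<Rightarrow> 's pmf) \<Rightarrow> ('s, 'a) policy \<Rightarrow> ('s, 'a) trajectory pmf" where
  "trajectory_law T p0 p P = bind_pmf p0 (trajectory_from p P T 0)"

definition state_at :: "('s, 'a) trajectory \<Rightarrow> nat \<Rightarrow> 's" where
  "state_at w t = fst (w ! t)"

definition action_at :: "('s, 'a) trajectory \<Rightarrow> nat \<Rightarrow> 'a" where
  "action_at w t = snd (w ! t)"

definition total_reward :: "nat \<Rightarrow> ('s \<Rightarrow> 'a \<Rightarrow> real) \<Rightarrow> ('s, 'a) trajectory \<Rightarrow> real" where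
  "total_reward T R w = (\<Sum>t<T. R (state_at w t) (action_at w t))"

definition feasible_policies ::
  "nat \<Rightarrow> (nat \<Rightarrow> 'a set) \<Rightarrow> 's pmf \<Rightarrow> ('a \<Rightarrow> 's \<Rightarrow> 's pmf) \<Rightarrow> ('s \<Rightarrow> 'a \<Rightarrow> real) \<Rightarrow> real
     \<Rightarrow> ('s, 'a) policy set" where
  "feasible_policies T Av p0 p R \<eta> =
     {P \<in> policies T Av.
       measure_pmf.expectation (trajectory_law T p0 p P) (total_reward T R) = \<eta>}"

text \<open>
  Expected loss of predicting with \<open>Q\<close> when actions follow \<open>P\<close>; for \<open>Q = P\<close> it is the
  generalized causal entropy of \<open>P\<close>.
\<close>

definition expected_log_loss ::
  "nat \<Rightarrow> 's pmf \<Rightarrow> ('a \<Rightarrow> 's \<Rightarrow> 's pmf) \<Rightarrow> (real \<Rightarrow> 's \<Rightarrow> real)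
     \<Rightarrow> ('s, 'a) policy \<Rightarrow> ('s, 'a) policy \<Rightarrow> real" where
  "expected_log_loss T p0 p G P Q =
     measure_pmf.expectation (trajectory_law T p0 p P)
       (\<lambda>w. - (\<Sum>t<T. ln (G (pmf (Q t (state_at w t)) (action_at w t)) (state_at w t))))"

text \<open>
  \<open>G\<close> and its inverse are only meant on the positive reals. The inverse is taken in the
  extensional function space, so that uniqueness refers to its values there only.
\<close>

definition admissible_G :: "(real \<Rightarrow> 's \<Rightarrow> real) \<Rightarrow> bool" where
  "admissible_G G \<longleftrightarrow>
     (\<forall>s. \<forall>x>0. 0 < G x s \<and> (\<exists>D>0. ((\<lambda>y. G y s) has_real_derivative D) (at x))) \<and>
     (\<forall>s. \<exists>!H. H \<in> {0<..} \<rightarrow>\<^sub>E {0<..} \<and> (\<forall>x>0. H (G x s) = x)) \<and>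
     (\<exists>\<mu>. \<forall>s. 0 < \<mu> s \<and>
        (\<forall>x>0. ((\<lambda>y. ln (G y s)) has_real_derivative \<mu> s / x) (at x)))"

end

theory Submission
  imports Defs
begin

text \<open>
  By the assumption on \<open>G\<close>, \<open>ln G(x|s) = \<mu>(s) ln x + c(s)\<close>, so Gibbs' inequality makes
  \<open>L(P,Q)\<close>, the expected loss of \<open>Q\<close> under \<open>P\<close>, minimal in \<open>Q\<close> at \<open>Q = P\<close>. Moreover \<open>L(P,Q)\<close> and
  the expected reward are linear in the occupancy measure of \<open>P\<close>. For feasible \<open>P\<close>, let \<open>P\<^sub>\<epsilon>\<close> be the
  policy with occupancy measure \<open>(1-\<epsilon>)\<close> times that of \<open>P\<^sup>*\<close> plus \<open>\<epsilon>\<close> times that of \<open>P\<close>; it is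
  feasible. Then \<open>L(P\<^sup>*,P\<^sup>*) \<ge> L(P\<^sub>\<epsilon>,P\<^sub>\<epsilon>) = (1-\<epsilon>) L(P\<^sup>*,P\<^sub>\<epsilon>) + \<epsilon> L(P,P\<^sub>\<epsilon>)
  \<ge> (1-\<epsilon>) L(P\<^sup>*,P\<^sup>*) + \<epsilon> L(P,P\<^sub>\<epsilon>)\<close>, hence \<open>L(P,P\<^sub>\<epsilon>) \<le> L(P\<^sup>*,P\<^sup>*)\<close>, and \<open>\<epsilon> \<rightarrow> 0\<close> gives
  \<open>L(P,P\<^sup>*) \<le> L(P\<^sup>*,P\<^sup>*)\<close>. So \<open>(P\<^sup>*,P\<^sup>*)\<close> is a saddle point of \<open>L\<close>.
\<close>

section \<open>State laws, occupancy measures and additive functionals\<close>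

primrec state_law ::
  "'s pmf \<Rightarrow> ('a \<Rightarrow> 's \<Rightarrow> 's pmf) \<Rightarrow> ('s, 'a) policy \<Rightarrow> nat \<Rightarrow> 's pmf" where
  "state_law p0 p P 0 = p0"
| "state_law p0 p P (Suc t) =
     bind_pmf (state_law p0 p P t) (\<lambda>s. bind_pmf (P t s) (\<lambda>a. p a s))"

definition occupancy ::
  "'s pmf \<Rightarrow> ('a \<Rightarrow> 's \<Rightarrow> 's pmf) \<Rightarrow> ('s, 'a) policy \<Rightarrow> nat \<Rightarrow> 's \<Rightarrow> 'a \<Rightarrow> real" where
  "occupancy p0 p P t s a = pmf (state_law p0 p P t) s * pmf (P t s) a"

lemma pmf_bind_finite:
  fixes M :: "'b::finite pmf"
  shows "pmf (bind_pmf M f) y = (\<Sum>x\<in>UNIV. pmf M x * pmf (f x) y)"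
  by (simp add: pmf_bind integral_measure_pmf[of UNIV])

text \<open>The flow equation: the next state law is linear in the occupancy measure, so mixtures of
  occupancy measures stay consistent over time.\<close>

lemma pmf_state_law_Suc:
  fixes p0 :: "'s::finite pmf" and P :: "('s, 'a::finite) policy"
  shows "pmf (state_law p0 p P (Suc t)) s' =
    (\<Sum>s\<in>UNIV. \<Sum>a\<in>UNIV. occupancy p0 p P t s a * pmf (p a s) s')"
  by (simp add: pmf_bind_finite occupancy_def sum_distrib_left mult.assoc)

lemma finite_set_trajectory_from:
  fixes P :: "('s::finite, 'a::finite) policy"
  shows "finite (set_pmf (trajectory_from p P n t s))"
  by (induction n arbitrary: t s) auto

text \<open>Induction on the horizon, with \<open>t\<close> arbitrary because
  \<open>trajectory_from\<close> peels off the first step: averaged over that step, the tail starts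
  from the state law at \<open>Suc t\<close>. Hence \<open>f\<close> is indexed by absolute
  time.\<close>

lemma expectation_trajectory_from:
  fixes p0 :: "'s::finite pmf" and P :: "('s, 'a::finite) policy"
    and f :: "nat \<Rightarrow> 's \<Rightarrow> 'a \<Rightarrow> real"
  shows "measure_pmf.expectation (bind_pmf (state_law p0 p P t) (trajectory_from p P n t))
       (\<lambda>w. \<Sum>k<n. f (t + k) (state_at w k) (action_at w k)) =
     (\<Sum>k<n. \<Sum>s\<in>UNIV. \<Sum>a\<in>UNIV. occupancy p0 p P (t + k) s a * f (t + k) s a)"
proof (induction n arbitrary: t)
  case 0
  show ?case by simp
next
  case (Suc n)
  let ?g = "\<lambda>t n w. \<Sum>k<n. f (t + k) (state_at w k) (action_at w k)"
  \<comment> \<open>The value-to-go: expected sum of \<open>f\<close> over the \<open>n\<close>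
    steps from time \<open>Suc t\<close> on.\<close>
  define V where
    "V s = measure_pmf.expectation (trajectory_from p P n (Suc t) s) (?g (Suc t) n)" for s
  note fin = finite_set_trajectory_from integrable_measure_pmf_finite
  have step: "measure_pmf.expectation (trajectory_from p P (Suc n) t s) (?g t (Suc n)) =
      (\<Sum>a\<in>UNIV. pmf (P t s) a * (f t s a + (\<Sum>s'\<in>UNIV. pmf (p a s) s' * V s')))" for s
  proof -
    have cons: "measure_pmf.expectation (map_pmf ((#) (s, a)) (trajectory_from p P n (Suc t) s'))
        (?g t (Suc n)) = f t s a + V s'" for a s'
      by (simp add: sum.lessThan_Suc_shift state_at_def action_at_def V_def fin del: sum.lessThan_Suc)
    have "measure_pmf.expectation (bind_pmf (p a s) (\<lambda>s'.
          map_pmf ((#) (s, a)) (trajectory_from p P n (Suc t) s'))) (?g t (Suc n)) =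
        f t s a + (\<Sum>s'\<in>UNIV. pmf (p a s) s' * V s')" for a
      by (subst pmf_expectation_bind[of UNIV])
        (simp_all add: finite_set_trajectory_from cons distrib_left sum.distrib sum_pmf_eq_1
          flip: sum_distrib_right del: sum.lessThan_Suc integral_map_pmf)
    then show ?thesis
      by (simp only: trajectory_from.simps, subst pmf_expectation_bind[of UNIV])
        (simp_all add: finite_set_trajectory_from del: sum.lessThan_Suc)
  qed
  have V: "(\<Sum>s'\<in>UNIV. pmf (state_law p0 p P (Suc t)) s' * V s') =
      (\<Sum>k<n. \<Sum>s\<in>UNIV. \<Sum>a\<in>UNIV. occupancy p0 p P (Suc t + k) s a * f (Suc t + k) s a)"
    unfolding Suc.IH[of "Suc t", symmetric] V_def
    by (subst pmf_expectation_bind[of UNIV]) (simp_all add: finite_set_trajectory_from)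
  have "measure_pmf.expectation (bind_pmf (state_law p0 p P t) (trajectory_from p P (Suc n) t))
      (?g t (Suc n)) =
    (\<Sum>s\<in>UNIV. pmf (state_law p0 p P t) s *
      (\<Sum>a\<in>UNIV. pmf (P t s) a * (f t s a + (\<Sum>s'\<in>UNIV. pmf (p a s) s' * V s'))))"
    by (subst pmf_expectation_bind[of UNIV])
      (auto simp: finite_set_trajectory_from step
        simp del: sum.lessThan_Suc trajectory_from.simps)
  also have "\<dots> = (\<Sum>s\<in>UNIV. \<Sum>a\<in>UNIV. occupancy p0 p P t s a * f t s a)
      + (\<Sum>s\<in>UNIV. \<Sum>a\<in>UNIV. \<Sum>s'\<in>UNIV. occupancy p0 p P t s a * pmf (p a s) s' * V s')"
    by (simp add: occupancy_def distrib_left sum.distrib sum_distrib_left mult.assoc)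
  \<comment> \<open>Moving the sum over \<open>s'\<close> outermost exposes the flow equation as the
    factor of \<open>V s'\<close>.\<close>
  also have "(\<Sum>s\<in>UNIV. \<Sum>a\<in>UNIV. \<Sum>s'\<in>UNIV. occupancy p0 p P t s a * pmf (p a s) s' * V s') =
      (\<Sum>s\<in>UNIV. \<Sum>s'\<in>UNIV. \<Sum>a\<in>UNIV. occupancy p0 p P t s a * pmf (p a s) s' * V s')"
    by (intro sum.cong refl sum.swap)
  also have "\<dots> =
      (\<Sum>s'\<in>UNIV. \<Sum>s\<in>UNIV. \<Sum>a\<in>UNIV. occupancy p0 p P t s a * pmf (p a s) s' * V s')"
    by (rule sum.swap)
  also have "\<dots> = (\<Sum>s'\<in>UNIV. pmf (state_law p0 p P (Suc t)) s' * V s')"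
    by (simp only: pmf_state_law_Suc sum_distrib_right)
  finally show ?case
    by (simp add: V sum.lessThan_Suc_shift del: sum.lessThan_Suc trajectory_from.simps state_law.simps)
qed

lemma expectation_trajectory_law:
  fixes p0 :: "'s::finite pmf" and P :: "('s, 'a::finite) policy"
    and f :: "nat \<Rightarrow> 's \<Rightarrow> 'a \<Rightarrow> real"
  shows "measure_pmf.expectation (trajectory_law T p0 p P)
       (\<lambda>w. \<Sum>t<T. f t (state_at w t) (action_at w t)) =
     (\<Sum>t<T. \<Sum>s\<in>UNIV. \<Sum>a\<in>UNIV. occupancy p0 p P t s a * f t s a)"
  using expectation_trajectory_from[where t = 0 and n = T] by (simp add: trajectory_law_def)

lemma expected_total_reward_eq:
  fixes p0 :: "'s::finite pmf" and P :: "('s, 'a::finite) policy"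
  shows "measure_pmf.expectation (trajectory_law T p0 p P) (total_reward T R) =
     (\<Sum>t<T. \<Sum>s\<in>UNIV. \<Sum>a\<in>UNIV. occupancy p0 p P t s a * R s a)"
  unfolding total_reward_def[abs_def]
  using expectation_trajectory_law[where f = "\<lambda>t s a. R s a"] .

lemma expected_log_loss_eq:
  fixes p0 :: "'s::finite pmf" and P Q :: "('s, 'a::finite) policy"
  shows "expected_log_loss T p0 p G P Q =
     - (\<Sum>t<T. \<Sum>s\<in>UNIV. \<Sum>a\<in>UNIV. occupancy p0 p P t s a * ln (G (pmf (Q t s) a) s))"
  unfolding expected_log_loss_def
  using expectation_trajectory_law[where f = "\<lambda>t s a. ln (G (pmf (Q t s) a) s)"]
  by simp

section \<open>Supports of policies and of their state laws\<close>

lemma policies_pmf_pos: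
  "P \<in> policies T Av \<Longrightarrow> t < T \<Longrightarrow> a \<in> Av t \<Longrightarrow> 0 < pmf (P t s) a"
  by (simp add: policies_def)

lemma policies_sum_eq_1:
  "P \<in> policies T Av \<Longrightarrow> t < T \<Longrightarrow> (\<Sum>a\<in>Av t. pmf (P t s) a) = 1"
  by (simp add: policies_def)

text \<open>The available actions already carry the whole mass 1 of the pmf.\<close>

lemma policies_pmf_eq_0:
  fixes Av :: "nat \<Rightarrow> 'a::finite set"
  assumes "P \<in> policies T Av" "t < T" "a \<notin> Av t"
  shows "pmf (P t s) a = 0"
proof -
  have "(\<Sum>b\<in>UNIV. pmf (P t s) b) = (\<Sum>b\<in>Av t. pmf (P t s) b) + (\<Sum>b\<in>-Av t. pmf (P t s) b)"
    by (subst sum.union_disjoint[symmetric]) auto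
  then have "(\<Sum>b\<in>-Av t. pmf (P t s) b) = 0"
    using policies_sum_eq_1[OF assms(1,2)] by (simp add: sum_pmf_eq_1)
  then show ?thesis
    using assms(3) by (subst (asm) sum_nonneg_eq_0_iff) auto
qed

lemma policies_pmf_pos_iff:
  fixes Av :: "nat \<Rightarrow> 'a::finite set"
  assumes "P \<in> policies T Av" "t < T"
  shows "0 < pmf (P t s) a \<longleftrightarrow> a \<in> Av t"
  using policies_pmf_pos[OF assms] policies_pmf_eq_0[OF assms] by fastforce

text \<open>All policies have support \<open>Av t\<close> in every state, so they reach the same
  states. This keeps the limit of the mixtures away from the singularity of \<open>ln\<close> at
  0.\<close>

lemma set_state_law_eq:
  fixes Av :: "nat \<Rightarrow> 'a::finite set"
  assumes "P \<in> policies T Av" "Q \<in> policies T Av" "t \<le> T"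
  shows "set_pmf (state_law p0 p P t) = set_pmf (state_law p0 p Q t)"
  using assms(3)
proof (induction t)
  case (Suc t)
  have "set_pmf (P t s) = set_pmf (Q t s)" for s
    using policies_pmf_pos_iff[OF assms(1)] policies_pmf_pos_iff[OF assms(2)] Suc.prems
    by (auto simp: set_pmf_iff pmf_positive_iff)
  with Suc show ?case by simp
qed simp

section \<open>The logarithm of \<open>G\<close> and Gibbs' inequality\<close>

text \<open>\<open>ln (G x s) - m * ln x\<close> has derivative 0 on the convex set of positive
  reals, hence is constant; the constant cancels in differences.\<close>

lemma admissible_G_ln_diff:
  assumes "admissible_G G"
  shows "\<exists>m>0. \<forall>x>0. \<forall>y>0. ln (G y s) - ln (G x s) = m * (ln y - ln x)"
proof -
  obtain m where m: "0 < m"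
    and D: "\<And>x. 0 < x \<Longrightarrow> ((\<lambda>y. ln (G y s)) has_real_derivative m / x) (at x)"
    using assms unfolding admissible_G_def by metis
  have "((\<lambda>y. ln (G y s) - m * ln y) has_real_derivative 0) (at x within {0<..})"
    if "x \<in> {0<..}" for x
  proof -
    have "((\<lambda>y. ln (G y s) - m * ln y) has_real_derivative m / x - m * (1 / x)) (at x)"
      using that by (intro DERIV_diff D DERIV_cmult DERIV_ln_divide) auto
    then show ?thesis by (simp add: has_field_derivative_at_within)
  qed
  then have "\<exists>c. \<forall>x\<in>{0<..}. ln (G x s) - m * ln x = c"
    by (intro has_field_derivative_zero_constant) auto
  then obtain c where c: "\<And>x. 0 < x \<Longrightarrow> ln (G x s) - m * ln x = c"
    by auto
  have "ln (G y s) - ln (G x s) = m * (ln y - ln x)" if "0 < x" "0 < y" for x y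
    using c[OF that(1)] c[OF that(2)] by (simp add: right_diff_distrib)
  with m show ?thesis by blast
qed

lemma admissible_G_tendsto_ln:
  assumes "admissible_G G" "(f \<longlongrightarrow> x) F" "0 < x"
  shows "((\<lambda>e. ln (G (f e) s)) \<longlongrightarrow> ln (G x s)) F"
proof -
  obtain m where "((\<lambda>y. ln (G y s)) has_real_derivative m) (at x)"
    using assms(1,3) unfolding admissible_G_def by metis
  then show ?thesis
    using assms(2) by (intro isCont_tendsto_compose[of x "\<lambda>y. ln (G y s)"] DERIV_isCont)
qed

text \<open>The gap is \<open>m\<close> times the Kullback-Leibler divergence of
  \<open>P t s\<close> from \<open>Q t s\<close>. The factor \<open>m\<close> depends on
  \<open>s\<close>, which is harmless as \<open>s\<close> is fixed.\<close>

lemma gibbs_inequality: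
  fixes Av :: "nat \<Rightarrow> 'a::finite set" and P Q :: "('s::finite, 'a) policy"
  assumes G: "admissible_G G" and P: "P \<in> policies T Av" and Q: "Q \<in> policies T Av"
    and t: "t < T"
  shows "(\<Sum>a\<in>UNIV. pmf (P t s) a * ln (G (pmf (Q t s) a) s)) \<le>
    (\<Sum>a\<in>UNIV. pmf (P t s) a * ln (G (pmf (P t s) a) s))"
proof -
  obtain m where m: "0 < m"
    and ln_diff: "\<And>x y. 0 < x \<Longrightarrow> 0 < y \<Longrightarrow> ln (G y s) - ln (G x s) = m * (ln y - ln x)"
    using admissible_G_ln_diff[OF G, of s] by blast
  \<comment> \<open>The tangent bound for \<open>ln\<close> gives a right side that sums to 0, both
    pmfs having mass 1. Outside \<open>Av t\<close> all terms vanish.\<close>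
  have "pmf (P t s) a * ln (G (pmf (Q t s) a) s) - pmf (P t s) a * ln (G (pmf (P t s) a) s)
      \<le> m * (pmf (Q t s) a - pmf (P t s) a)" (is "?l \<le> _") for a
  proof (cases "a \<in> Av t")
    case True
    then have pos: "0 < pmf (P t s) a" "0 < pmf (Q t s) a"
      by (auto intro: policies_pmf_pos[OF P t] policies_pmf_pos[OF Q t])
    have "?l = m * (pmf (P t s) a * (ln (pmf (Q t s) a) - ln (pmf (P t s) a)))"
      by (simp add: ln_diff pos flip: right_diff_distrib)
    also have "pmf (P t s) a * (ln (pmf (Q t s) a) - ln (pmf (P t s) a))
        \<le> pmf (P t s) a * ((pmf (Q t s) a - pmf (P t s) a) / pmf (P t s) a)"
      using pos by (intro mult_left_mono ln_diff_le) auto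
    finally show ?thesis using m pos by simp
  next
    case False
    then show ?thesis by (simp add: policies_pmf_eq_0[OF P t] policies_pmf_eq_0[OF Q t])
  qed
  then have "(\<Sum>a\<in>UNIV. pmf (P t s) a * ln (G (pmf (Q t s) a) s)
        - pmf (P t s) a * ln (G (pmf (P t s) a) s))
      \<le> (\<Sum>a\<in>UNIV. m * (pmf (Q t s) a - pmf (P t s) a))"
    by (rule sum_mono)
  also have "\<dots> = 0"
    by (simp add: sum_subtractf sum_pmf_eq_1 flip: sum_distrib_left)
  finally show ?thesis by (simp add: sum_subtractf)
qed

text \<open>The state law in the loss depends on \<open>P\<close> only, so Gibbs' inequality can be
  averaged with the same nonnegative weights on both sides.\<close>

lemma expected_log_loss_self_le:
  fixes Av :: "nat \<Rightarrow> 'a::finite set" and P Q :: "('s::finite, 'a) policy"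
  assumes "admissible_G G" "P \<in> policies T Av" "Q \<in> policies T Av"
  shows "expected_log_loss T p0 p G P P \<le> expected_log_loss T p0 p G P Q"
proof -
  have "(\<Sum>t<T. \<Sum>s\<in>UNIV. pmf (state_law p0 p P t) s *
          (\<Sum>a\<in>UNIV. pmf (P t s) a * ln (G (pmf (Q t s) a) s)))
      \<le> (\<Sum>t<T. \<Sum>s\<in>UNIV. pmf (state_law p0 p P t) s *
          (\<Sum>a\<in>UNIV. pmf (P t s) a * ln (G (pmf (P t s) a) s)))"
    by (intro sum_mono mult_left_mono gibbs_inequality[OF assms]) auto
  then show ?thesis
    by (simp add: expected_log_loss_eq occupancy_def sum_distrib_left mult.assoc)
qed

section \<open>Policies realizing mixtures of occupancy measures\<close>

text \<open>
  In a state that has probability 0 under both policies the weight is \<open>0 / 0 = 0\<close>, so that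
  the mixture follows \<open>P\<close> there.
\<close>

definition mixture_weight ::
  "'s pmf \<Rightarrow> ('a \<Rightarrow> 's \<Rightarrow> 's pmf) \<Rightarrow> ('s, 'a) policy \<Rightarrow> ('s, 'a) policy \<Rightarrow> real \<Rightarrow> nat \<Rightarrow> 's \<Rightarrow> real"
where
  "mixture_weight p0 p P Q e t s = e * pmf (state_law p0 p Q t) s /
     ((1 - e) * pmf (state_law p0 p P t) s + e * pmf (state_law p0 p Q t) s)"

text \<open>If \<open>Q\<close> is chosen at the outset with probability \<open>e\<close> and
  \<open>P\<close> otherwise, the weight is the posterior probability of \<open>Q\<close> given
  state \<open>s\<close> at time \<open>t\<close>. The coin makes the result a pmf by
  construction.\<close>

definition mixture_policy ::
  "'s pmf \<Rightarrow> ('a \<Rightarrow> 's \<Rightarrow> 's pmf) \<Rightarrow> ('s, 'a) policy \<Rightarrow> ('s, 'a) policy \<Rightarrow> real \<Rightarrow> ('s, 'a) policy"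
where
  "mixture_policy p0 p P Q e t s =
     bind_pmf (bernoulli_pmf (mixture_weight p0 p P Q e t s)) (\<lambda>b. if b then Q t s else P t s)"

lemma mixture_weight_bounds:
  assumes "0 \<le> e" "e \<le> 1"
  shows "0 \<le> mixture_weight p0 p P Q e t s" "mixture_weight p0 p P Q e t s \<le> 1"
proof -
  have "0 \<le> y / (x + y) \<and> y / (x + y) \<le> 1" if "0 \<le> x" "0 \<le> y" for x y :: real
    using that by (cases "x + y = 0") (simp_all add: divide_le_eq_1)
  from this[of "(1 - e) * pmf (state_law p0 p P t) s" "e * pmf (state_law p0 p Q t) s"] assms
  show "0 \<le> mixture_weight p0 p P Q e t s" "mixture_weight p0 p P Q e t s \<le> 1"
    by (simp_all add: mixture_weight_def)
qed

lemma pmf_mixture_policy: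
  assumes "0 \<le> e" "e \<le> 1"
  shows "pmf (mixture_policy p0 p P Q e t s) a =
    mixture_weight p0 p P Q e t s * pmf (Q t s) a
      + (1 - mixture_weight p0 p P Q e t s) * pmf (P t s) a"
  by (simp add: mixture_policy_def pmf_bind_finite UNIV_bool mixture_weight_bounds[OF assms])

lemma mixture_policy_in_policies:
  assumes P: "P \<in> policies T Av" and Q: "Q \<in> policies T Av" and e: "0 \<le> e" "e \<le> 1"
  shows "mixture_policy p0 p P Q e \<in> policies T Av"
  unfolding policies_def
proof (intro CollectI allI impI conjI ballI)
  fix t s assume t: "t < T"
  define w where "w = mixture_weight p0 p P Q e t s"
  have w: "0 \<le> w" "w \<le> 1"
    using mixture_weight_bounds[OF e] by (simp_all add: w_def)
  note pmf = pmf_mixture_policy[OF e, of p0 p P Q t s, folded w_def]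
  show "0 < pmf (mixture_policy p0 p P Q e t s) a" if "a \<in> Av t" for a
  proof (cases "w = 0")
    case True
    then show ?thesis using policies_pmf_pos[OF P t that] by (simp add: pmf)
  next
    case False
    then show ?thesis
      using policies_pmf_pos[OF Q t that] w by (simp add: pmf add_pos_nonneg)
  qed
  show "(\<Sum>a\<in>Av t. pmf (mixture_policy p0 p P Q e t s) a) = 1"
    using policies_sum_eq_1[OF P t] policies_sum_eq_1[OF Q t]
    by (simp add: pmf sum.distrib flip: sum_distrib_left)
qed

text \<open>The denominator of the weight is the mixed state probability and cancels. Assuming
  \<open>d\<close> lets the lemma serve inside the induction that proves \<open>d\<close>.\<close>

lemma occupancy_mixture_of_state_law:
  assumes e: "0 \<le> e" "e \<le> 1"
    and d: "pmf (state_law p0 p (mixture_policy p0 p P Q e) t) s =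
      (1 - e) * pmf (state_law p0 p P t) s + e * pmf (state_law p0 p Q t) s"
  shows "occupancy p0 p (mixture_policy p0 p P Q e) t s a =
    (1 - e) * occupancy p0 p P t s a + e * occupancy p0 p Q t s a"
proof -
  define x y where "x = (1 - e) * pmf (state_law p0 p P t) s"
    and "y = e * pmf (state_law p0 p Q t) s"
  define w where "w = mixture_weight p0 p P Q e t s"
  have xy: "0 \<le> x" "0 \<le> y" using e by (simp_all add: x_def y_def)
  have w: "w = y / (x + y)" by (simp add: w_def mixture_weight_def x_def y_def)
  \<comment> \<open>If \<open>x + y = 0\<close>, nonnegativity forces \<open>y = 0\<close>, so
    division by zero does no harm.\<close>
  have "(x + y) * w = y" using xy by (cases "x + y = 0") (auto simp: w)
  moreover from this have "(x + y) * (1 - w) = x" by (simp add: algebra_simps)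
  ultimately have "(x + y) * (w * pmf (Q t s) a + (1 - w) * pmf (P t s) a) =
      y * pmf (Q t s) a + x * pmf (P t s) a"
    by (metis distrib_left mult.assoc)
  then show ?thesis
    by (simp add: occupancy_def d pmf_mixture_policy[OF e] x_def y_def w_def mult.assoc add.commute)
qed

text \<open>Mixed state laws at \<open>t\<close> give mixed occupancies at \<open>t\<close>, and the
  flow equation carries them to \<open>Suc t\<close>.\<close>

lemma pmf_state_law_mixture:
  fixes p0 :: "'s::finite pmf" and P Q :: "('s, 'a::finite) policy"
  assumes "0 \<le> e" "e \<le> 1"
  shows "pmf (state_law p0 p (mixture_policy p0 p P Q e) t) s =
    (1 - e) * pmf (state_law p0 p P t) s + e * pmf (state_law p0 p Q t) s"
proof (induction t arbitrary: s)
  case 0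
  show ?case by (simp add: algebra_simps)
next
  case (Suc t)
  show ?case
    by (simp add: pmf_state_law_Suc occupancy_mixture_of_state_law[OF assms Suc.IH]
        distrib_right sum.distrib sum_distrib_left mult.assoc del: state_law.simps)
qed

lemma sum_occupancy_mixture:
  fixes p0 :: "'s::finite pmf" and P Q :: "('s, 'a::finite) policy"
  assumes "0 \<le> e" "e \<le> 1"
  shows "(\<Sum>t<T. \<Sum>s\<in>UNIV. \<Sum>a\<in>UNIV. occupancy p0 p (mixture_policy p0 p P Q e) t s a * f t s a) =
    (1 - e) * (\<Sum>t<T. \<Sum>s\<in>UNIV. \<Sum>a\<in>UNIV. occupancy p0 p P t s a * f t s a)
    + e * (\<Sum>t<T. \<Sum>s\<in>UNIV. \<Sum>a\<in>UNIV. occupancy p0 p Q t s a * f t s a)"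
  by (simp add: occupancy_mixture_of_state_law[OF assms pmf_state_law_mixture[OF assms]]
      distrib_right sum.distrib sum_distrib_left mult.assoc)

lemma mixture_policy_feasible:
  fixes p0 :: "'s::finite pmf" and P Q :: "('s, 'a::finite) policy"
  assumes "P \<in> feasible_policies T Av p0 p R \<eta>" "Q \<in> feasible_policies T Av p0 p R \<eta>"
    and "0 \<le> e" "e \<le> 1"
  shows "mixture_policy p0 p P Q e \<in> feasible_policies T Av p0 p R \<eta>"
  using assms
  by (simp add: feasible_policies_def mixture_policy_in_policies expected_total_reward_eq
      sum_occupancy_mixture left_diff_distrib)

lemma expected_log_loss_mixture:
  fixes p0 :: "'s::finite pmf" and P Q :: "('s, 'a::finite) policy"
  assumes "0 \<le> e" "e \<le> 1"
  shows "expected_log_loss T p0 p G (mixture_policy p0 p P Q e) Q' =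
    (1 - e) * expected_log_loss T p0 p G P Q' + e * expected_log_loss T p0 p G Q Q'"
  by (simp add: expected_log_loss_eq sum_occupancy_mixture[OF assms])

section \<open>The limit of vanishing mixture weight\<close>

text \<open>Positivity keeps the denominator of the weight away from 0. In a state reached by
  \<open>Q\<close> but not by \<open>P\<close> the weight would be 1 for every
  \<open>e > 0\<close>.\<close>

lemma tendsto_pmf_mixture_policy:
  assumes "0 < pmf (state_law p0 p P t) s"
  shows "((\<lambda>e. pmf (mixture_policy p0 p P Q e t s) a) \<longlongrightarrow> pmf (P t s) a) (at_right 0)"
proof -
  have "((\<lambda>e. mixture_weight p0 p P Q e t s) \<longlongrightarrow> 0) (at_right 0)"
    unfolding mixture_weight_def using assms by (auto intro!: tendsto_eq_intros)
  then have "((\<lambda>e. mixture_weight p0 p P Q e t s * pmf (Q t s) a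
      + (1 - mixture_weight p0 p P Q e t s) * pmf (P t s) a) \<longlongrightarrow> pmf (P t s) a) (at_right 0)"
    by (auto intro!: tendsto_eq_intros)
  moreover have "\<forall>\<^sub>F e in at_right 0. pmf (mixture_policy p0 p P Q e t s) a =
      mixture_weight p0 p P Q e t s * pmf (Q t s) a
      + (1 - mixture_weight p0 p P Q e t s) * pmf (P t s) a"
    using eventually_at_right_real[of 0 "1::real"] by (auto elim!: eventually_mono simp: pmf_mixture_policy)
  ultimately show ?thesis by (simp cong: tendsto_cong)
qed

lemma tendsto_expected_log_loss_mixture:
  fixes p0 :: "'s::finite pmf" and P Q :: "('s, 'a::finite) policy"
  assumes G: "admissible_G G" and P: "P \<in> policies T Av" and Q: "Q \<in> policies T Av"
  shows "((\<lambda>e. expected_log_loss T p0 p G Q (mixture_policy p0 p P Q e))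
    \<longlongrightarrow> expected_log_loss T p0 p G Q P) (at_right 0)"
  unfolding expected_log_loss_eq
proof (intro tendsto_minus tendsto_sum)
  fix t s a assume "t \<in> {..<T}"
  then have t: "t < T" by simp
  show "((\<lambda>e. occupancy p0 p Q t s a * ln (G (pmf (mixture_policy p0 p P Q e t s) a) s))
    \<longlongrightarrow> occupancy p0 p Q t s a * ln (G (pmf (P t s) a) s)) (at_right 0)"
  \<comment> \<open>Terms of zero occupancy are constantly 0; otherwise equality of supports makes
    state and action positive under \<open>P\<close> too.\<close>
  proof (cases "occupancy p0 p Q t s a = 0")
    case False
    then have "pmf (state_law p0 p Q t) s \<noteq> 0" "0 < pmf (Q t s) a"
      by (auto simp: occupancy_def pmf_positive_iff set_pmf_iff)
    then have "0 < pmf (state_law p0 p P t) s" "0 < pmf (P t s) a"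
      using set_state_law_eq[OF P Q, of t p0 p] t
        policies_pmf_pos_iff[OF P t] policies_pmf_pos_iff[OF Q t]
      by (auto simp: set_eq_iff set_pmf_iff pmf_positive_iff)
    then show ?thesis
      by (intro tendsto_intros admissible_G_tendsto_ln[OF G] tendsto_pmf_mixture_policy)
  qed simp
qed

section \<open>The saddle point\<close>

lemma expected_log_loss_le_arg_max:
  fixes p0 :: "'s::finite pmf" and P Pstar :: "('s, 'a::finite) policy"
  assumes G: "admissible_G G"
    and max: "is_arg_max (\<lambda>P. expected_log_loss T p0 p G P P)
      (\<lambda>P. P \<in> feasible_policies T Av p0 p R \<eta>) Pstar"
    and P: "P \<in> feasible_policies T Av p0 p R \<eta>"
  shows "expected_log_loss T p0 p G P Pstar \<le> expected_log_loss T p0 p G Pstar Pstar"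
proof -
  let ?L = "expected_log_loss T p0 p G"
  have feas: "Pstar \<in> feasible_policies T Av p0 p R \<eta>"
    and opt: "\<And>P. P \<in> feasible_policies T Av p0 p R \<eta> \<Longrightarrow> ?L P P \<le> ?L Pstar Pstar"
    using max by (auto simp: is_arg_max_linorder)
  have pol: "Pstar \<in> policies T Av" "P \<in> policies T Av"
    using feas P by (auto simp: feasible_policies_def)
  have "?L P (mixture_policy p0 p Pstar P e) \<le> ?L Pstar Pstar" if e: "0 < e" "e < 1" for e
  proof -
    let ?M = "mixture_policy p0 p Pstar P e"
    \<comment> \<open>With the predictor \<open>?M\<close> held fixed, the loss is affine in the
      acting policy, so the two losses recombine into the entropy of \<open>?M\<close>.\<close>
    have "(1 - e) * ?L Pstar Pstar + e * ?L P ?M \<le> (1 - e) * ?L Pstar ?M + e * ?L P ?M"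
      using e by (intro add_mono mult_left_mono expected_log_loss_self_le[OF G pol(1)]
          mixture_policy_in_policies pol) auto
    also have "\<dots> = ?L ?M ?M"
      using e by (simp add: expected_log_loss_mixture)
    also have "\<dots> \<le> ?L Pstar Pstar"
      using e by (intro opt mixture_policy_feasible feas P) auto
    finally have "e * ?L P ?M \<le> e * ?L Pstar Pstar" by (simp add: algebra_simps)
    with e show ?thesis by simp
  qed
  then have "\<forall>\<^sub>F e in at_right 0. ?L P (mixture_policy p0 p Pstar P e) \<le> ?L Pstar Pstar"
    using eventually_at_right_real[of 0 "1::real"] by (auto elim!: eventually_mono)
  then show ?thesis
    by (rule tendsto_upperbound[OF tendsto_expected_log_loss_mixture[OF G pol]]) simp
qed

theorem theorem2:
  fixes T :: nat
    and Av :: "nat \<Rightarrow> 'a::finite set"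
    and p0 :: "'s::finite pmf"
    and p :: "'a \<Rightarrow> 's \<Rightarrow> 's pmf"
    and R :: "'s \<Rightarrow> 'a \<Rightarrow> real"
    and \<eta> :: real
    and G :: "real \<Rightarrow> 's \<Rightarrow> real"
    and Pstar :: "('s, 'a) policy"
  assumes "1 \<le> T"
    and "\<And>t. t < T \<Longrightarrow> Av t \<noteq> {}"
    and "admissible_G G"
    and "is_arg_max (\<lambda>P. expected_log_loss T p0 p G P P)
           (\<lambda>P. P \<in> feasible_policies T Av p0 p R \<eta>) Pstar"
  shows "Pstar \<in> policies T Av \<and>
    (SUP P \<in> feasible_policies T Av p0 p R \<eta>. ereal (expected_log_loss T p0 p G P Pstar)) =
    (INF Q \<in> policies T Av. SUP P \<in> feasible_policies T Av p0 p R \<eta>.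
       ereal (expected_log_loss T p0 p G P Q))"
proof -
  let ?L = "expected_log_loss T p0 p G" and ?F = "feasible_policies T Av p0 p R \<eta>"
  have feas: "Pstar \<in> ?F"
    using assms(4) by (simp add: is_arg_max_def)
  then have pol: "Pstar \<in> policies T Av"
    by (simp add: feasible_policies_def)
  have "(SUP P\<in>?F. ereal (?L P Pstar)) \<le> ereal (?L Pstar Pstar)"
    using expected_log_loss_le_arg_max[OF assms(3,4)] by (intro SUP_least) simp
  \<comment> \<open>For each \<open>Q\<close> the supremum is tested at \<open>Pstar\<close> itself,
    which is feasible.\<close>
  also have "\<dots> \<le> (INF Q\<in>policies T Av. SUP P\<in>?F. ereal (?L P Q))"
    using expected_log_loss_self_le[OF assms(3) pol]
    by (intro INF_greatest SUP_upper2[OF feas]) simp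
  finally show ?thesis
    using pol by (auto intro!: antisym INF_lower)
qed

end
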